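(* Let $\varrho$ be a state acting on the Hilbert space $\mathbb{C}^d\otimes\mathbb{C}^d$. Then $\mathcal{M}(\varrho)$ is bounded from above by the information content $I(\varrho)=2\log_2 d-S(\varrho)$ of $\varrho$: $$\mathcal{M}(\varrho)\leq I(\varrho)=2\log_2 d-S(\varrho).$$
   Context: A state is a density matrix; $S(\varrho)=-\mathrm{Tr}\,\varrho\log_2\varrho$ is the von Neumann entropy. $\mathcal{PS}$ denotes the set of product states $\varrho_A\otimes\varrho_B$. A von Neumann measurement $\mathcal{P}=\{P_i\}$ is a complete family of mutually orthogonal rank-one projectors on $\mathbb{C}^d\otimes\mathbb{C}^d$ (not necessarily of product form) summing to the identity. The Klein entropy is $H(\varrho,\mathcal{P})=-\sum_i p_i\log_2 p_i$ with $p_i=\mathrm{Tr}(\varrho P_i)$ and $0\log_2 0=0$. The entropic entanglement parameter is $$\mathcal{M}(\varrho)=\sup_{\mathcal{P}}\Big(\inf_{\delta\in\mathcal{PS}}H(\delta,\mathcal{P})-H(\varrho,\mathcal{P})\Big),$$ the supremum being over all von Neumann measurements. *)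

theory Defs
  imports "HOL-Analysis.Analysis"
begin

text \<open>
  Operators on $\mathbb{C}^d$ are matrices over a finite index type \<open>'d\<close> with \<open>CARD('d) = d\<close>;
  operators on $\mathbb{C}^d \otimes \mathbb{C}^d$ are matrices indexed by \<open>'d \<times> 'd\<close>.
\<close>

definition mat_adjoint :: "complex^'n^'m \<Rightarrow> complex^'m^'n" where
  "mat_adjoint A = map_matrix cnj (transpose A)"

definition hermitian :: "complex^'n^'n \<Rightarrow> bool" where
  "hermitian A \<longleftrightarrow> mat_adjoint A = A"

definition positive_semidef :: "complex^'n^'n \<Rightarrow> bool" where
  "positive_semidef A \<longleftrightarrow> hermitian A \<and> (\<forall>x. 0 \<le> Re (\<Sum>i\<in>UNIV. cnj (x $ i) * (A *v x) $ i))"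

definition density_matrix :: "complex^'n^'n \<Rightarrow> bool" where
  "density_matrix \<rho> \<longleftrightarrow> positive_semidef \<rho> \<and> trace \<rho> = 1"

definition tensor_mat ::
  "complex^'a^'a \<Rightarrow> complex^'b^'b \<Rightarrow> complex^('a::finite \<times> 'b::finite)^('a \<times> 'b)" where
  "tensor_mat A B = (\<chi> i j. A $ fst i $ fst j * B $ snd i $ snd j)"

definition product_states :: "(complex^('d::finite \<times> 'd)^('d \<times> 'd)) set" where
  "product_states = {tensor_mat \<rho>A \<rho>B | \<rho>A \<rho>B. density_matrix \<rho>A \<and> density_matrix \<rho>B}"

definition orthogonal_projector :: "complex^'n^'n \<Rightarrow> bool" where
  "orthogonal_projector P \<longleftrightarrow> hermitian P \<and> P ** P = P"

text \<open>
  Functional calculus $f(A) = \sum_\lambda f(\lambda) \Pi_\lambda$ of a Hermitian matrix, where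
  $\Pi_\lambda$ is the orthogonal projector onto the eigenspace of $\lambda$. All eigenvalues of a
  Hermitian matrix are real.
\<close>

definition eigenspace :: "complex^'n^'n \<Rightarrow> real \<Rightarrow> (complex^'n) set" where
  "eigenspace A l = {x. A *v x = complex_of_real l *s x}"

definition real_eigenvalues :: "complex^'n^'n \<Rightarrow> real set" where
  "real_eigenvalues A = {l. \<exists>x. x \<noteq> 0 \<and> x \<in> eigenspace A l}"

definition eigenprojector :: "complex^'n^'n \<Rightarrow> real \<Rightarrow> complex^'n^'n" where
  "eigenprojector A l = (THE P. orthogonal_projector P \<and> range ((*v) P) = eigenspace A l)"

definition hermitian_fun :: "(real \<Rightarrow> real) \<Rightarrow> complex^'n^'n \<Rightarrow> complex^'n^'n" where
  "hermitian_fun f A = (\<Sum>l\<in>real_eigenvalues A. f l *\<^sub>R eigenprojector A l)"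

text \<open>
  The value of \<open>log 2 0\<close> is irrelevant below: in the von Neumann entropy it multiplies the
  projector onto the kernel of \<open>\<rho>\<close>, which \<open>\<rho>\<close> annihilates, and in the Klein entropy it is
  multiplied by $0$. So both definitions follow the convention $0 \log_2 0 = 0$.
\<close>

definition von_neumann_entropy :: "complex^'n^'n \<Rightarrow> real" where
  "von_neumann_entropy \<rho> = - Re (trace (\<rho> ** hermitian_fun (log 2) \<rho>))"

text \<open>
  A measurement is given by its set of projectors; nothing is lost compared with indexed families,
  since mutually orthogonal nonzero projectors are distinct.
\<close>

definition von_neumann_measurement :: "(complex^'n^'n) set \<Rightarrow> bool" where
  "von_neumann_measurement \<P> \<longleftrightarrow> finite \<P> \<and>
     (\<forall>P\<in>\<P>. orthogonal_projector P \<and> rank P = 1) \<and>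
     (\<forall>P\<in>\<P>. \<forall>Q\<in>\<P>. P \<noteq> Q \<longrightarrow> P ** Q = 0) \<and>
     (\<Sum>P\<in>\<P>. P) = mat 1"

definition outcome_prob :: "complex^'n^'n \<Rightarrow> complex^'n^'n \<Rightarrow> real" where
  "outcome_prob \<rho> P = Re (trace (\<rho> ** P))"

definition klein_entropy :: "complex^'n^'n \<Rightarrow> (complex^'n^'n) set \<Rightarrow> real" where
  "klein_entropy \<rho> \<P> = - (\<Sum>P\<in>\<P>. outcome_prob \<rho> P * log 2 (outcome_prob \<rho> P))"

text \<open>
  For states, the Klein entropy lies in $[0, 2 \log_2 d]$, and product states and measurements
  exist; hence the infimum and supremum below are over nonempty bounded sets of reals.
\<close>

definition entropic_entanglement :: "complex^('d::finite \<times> 'd)^('d \<times> 'd) \<Rightarrow> real" where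
  "entropic_entanglement \<rho> =
     (SUP \<P>\<in>{\<P>. von_neumann_measurement \<P>}.
        (INF \<delta>\<in>product_states. klein_entropy \<delta> \<P>) - klein_entropy \<rho> \<P>)"

definition information_content :: "complex^('d::finite \<times> 'd)^('d \<times> 'd) \<Rightarrow> real" where
  "information_content \<rho> = 2 * log 2 (real CARD('d)) - von_neumann_entropy \<rho>"

end

theory Submission
  imports Defs
begin

text \<open>
  A measurement on $\mathbb{C}^d \otimes \mathbb{C}^d$ has $d^2$ outcomes, so the Klein entropy of
  any product state is at most $2 \log_2 d$. On the other hand
  $S(\varrho) \le H(\varrho, \mathcal{P})$ for every measurement: the outcome probabilities are
  averages of the eigenvalues of \<open>\<rho>\<close>, and $x \log_2 x$ is convex.

  The spectral theorem is derived from the real inner product of \<open>complex^'n\<close>, which is the real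
  part of the Hermitian one; real orthogonality to a complex subspace is complex orthogonality.
\<close>

section \<open>Adjoints and traces\<close>

lemma inner_vec_complex:
  fixes x y :: "complex^'n"
  shows "x \<bullet> y = Re (\<Sum>i\<in>UNIV. cnj (x $ i) * y $ i)"
  by (simp add: inner_vec_def inner_complex_def)

lemma mat_adjoint_nth [simp]: "mat_adjoint A $ i $ j = cnj (A $ j $ i)"
  by (simp add: mat_adjoint_def transpose_def)

lemma mat_adjoint_mult: "mat_adjoint (A ** B) = mat_adjoint B ** mat_adjoint A"
  by (simp add: vec_eq_iff matrix_matrix_mult_def mult.commute)

lemma mat_adjoint_mat_adjoint [simp]: "mat_adjoint (mat_adjoint A) = A"
  by (simp add: vec_eq_iff)

lemma mat_adjoint_scaleR: "mat_adjoint (c *\<^sub>R A) = c *\<^sub>R mat_adjoint A"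
  by (simp add: vec_eq_iff)

lemma mat_adjoint_sum: "mat_adjoint (\<Sum>i\<in>I. f i) = (\<Sum>i\<in>I. mat_adjoint (f i))"
  by (simp add: vec_eq_iff)

lemma inner_mat_adjoint:
  fixes A :: "complex^'n^'m"
  shows "(A *v x) \<bullet> y = x \<bullet> (mat_adjoint A *v y)"
proof -
  have "(\<Sum>i\<in>UNIV. cnj ((A *v x) $ i) * y $ i)
      = (\<Sum>i\<in>UNIV. \<Sum>j\<in>UNIV. cnj (A $ i $ j) * cnj (x $ j) * y $ i)"
    by (simp add: matrix_vector_mult_def sum_distrib_right)
  also have "\<dots> = (\<Sum>j\<in>UNIV. \<Sum>i\<in>UNIV. cnj (A $ i $ j) * cnj (x $ j) * y $ i)"
    by (rule sum.swap)
  also have "\<dots> = (\<Sum>j\<in>UNIV. cnj (x $ j) * (mat_adjoint A *v y) $ j)"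
    by (simp add: matrix_vector_mult_def sum_distrib_left mult_ac)
  finally show ?thesis
    by (simp add: inner_vec_complex)
qed

text \<open>The real part of the Hermitian form already separates vectors, so symmetry with respect
  to the real inner product determines the adjoint.\<close>

lemma hermitian_iff_inner:
  fixes A :: "complex^'n^'n"
  shows "hermitian A \<longleftrightarrow> (\<forall>x y. (A *v x) \<bullet> y = x \<bullet> (A *v y))"
proof
  assume *: "\<forall>x y. (A *v x) \<bullet> y = x \<bullet> (A *v y)"
  have "mat_adjoint A *v y = A *v y" for y
  proof (rule vector_eq_ldot[THEN iffD1], rule allI)
    fix x show "x \<bullet> (mat_adjoint A *v y) = x \<bullet> (A *v y)"
      using * by (simp add: inner_mat_adjoint[symmetric])
  qed
  then show "hermitian A"
    by (simp add: hermitian_def matrix_eq)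
next
  assume "hermitian A"
  then show "\<forall>x y. (A *v x) \<bullet> y = x \<bullet> (A *v y)"
    by (simp add: inner_mat_adjoint hermitian_def)
qed

lemma positive_semidef_iff_inner:
  "positive_semidef A \<longleftrightarrow> hermitian A \<and> (\<forall>x. 0 \<le> x \<bullet> (A *v x))"
  by (simp only: positive_semidef_def inner_vec_complex)

text \<open>The quadratic form at \<open>x\<close> is the squared norm of \<open>B *v x\<close>.
  Projectors and tensor products of states are shown to be positive through this form.\<close>

lemma positive_semidef_adjoint_mult:
  fixes B :: "complex^'n^'n"
  shows "positive_semidef (mat_adjoint B ** B)"
  unfolding positive_semidef_iff_inner
proof (intro conjI allI)
  show "hermitian (mat_adjoint B ** B)"
    by (simp add: hermitian_def mat_adjoint_mult)
  fix x
  have "x \<bullet> ((mat_adjoint B ** B) *v x) = (B *v x) \<bullet> (B *v x)"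
    by (simp add: inner_mat_adjoint matrix_vector_mul_assoc)
  then show "0 \<le> x \<bullet> ((mat_adjoint B ** B) *v x)"
    by simp
qed

lemma trace_adjoint_mult_nonneg:
  fixes B :: "complex^'n^'n"
  shows "0 \<le> Re (trace (mat_adjoint B ** B))"
  by (auto simp: trace_def matrix_matrix_mult_def intro!: sum_nonneg)

lemma trace_sum: "trace (\<Sum>i\<in>I. f i) = (\<Sum>i\<in>I. trace (f i :: 'a::comm_semiring_1^'n^'n))"
  by (induction I rule: infinite_finite_induct) (simp_all add: trace_add trace_0[simplified mat_0])

lemma trace_scaleR: "trace (c *\<^sub>R A) = c *\<^sub>R trace (A :: complex^'n^'n)"
  by (simp add: trace_def scaleR_sum_right)

lemma matrix_mult_sum_left:
  "(\<Sum>i\<in>I. f i) ** B = (\<Sum>i\<in>I. f i ** (B :: 'a::semiring_1^'p^'n))"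
  by (simp add: vec_eq_iff matrix_matrix_mult_def sum_distrib_right)
    (intro allI sum.swap)

lemma matrix_mult_sum_right:
  "B ** (\<Sum>i\<in>I. f i) = (\<Sum>i\<in>I. (B :: 'a::semiring_1^'p^'n) ** f i)"
  by (induction I rule: infinite_finite_induct) (simp_all add: matrix_add_ldistrib)

lemma of_real_vector_scalar_mult: "complex_of_real c *s (x :: complex^'n) = c *\<^sub>R x"
  by (simp add: vec_eq_iff scaleR_conv_of_real[where 'a=complex])

lemma matrix_vector_mult_scaleR_complex:
  "(A :: complex^'n^'m) *v (c *\<^sub>R x) = c *\<^sub>R (A *v x)"
  by (simp add: linear_scale)

lemma scaleR_matrix_vector_mult:
  "(c *\<^sub>R A) *v x = c *\<^sub>R ((A :: complex^'n^'m) *v x)"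
  by (simp add: vec_eq_iff matrix_vector_mult_def scaleR_sum_right)


section \<open>Orthogonal projectors\<close>

text \<open>By idempotence and cyclicity the trace equals that of
  \<open>mat_adjoint (P ** Q) ** (P ** Q)\<close>, a sum of squared moduli. These traces later serve
  as the weights in Jensen's inequality.\<close>

lemma trace_projector_mult_nonneg:
  assumes P: "orthogonal_projector P" and Q: "orthogonal_projector Q"
  shows "0 \<le> Re (trace (P ** Q))"
proof -
  have "trace (P ** Q) = trace ((P ** (P ** Q)) ** Q)"
    using P Q by (metis orthogonal_projector_def matrix_mul_assoc)
  also have "\<dots> = trace (Q ** (P ** (P ** Q)))"
    by (rule trace_mul_sym)
  also have "\<dots> = trace (mat_adjoint (P ** Q) ** (P ** Q))"
    using P Q by (simp add: orthogonal_projector_def hermitian_def mat_adjoint_mult)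
      (metis matrix_mul_assoc)
  finally show ?thesis
    by (simp only: trace_adjoint_mult_nonneg)
qed

lemma projector_positive_semidef:
  "orthogonal_projector P \<Longrightarrow> positive_semidef P"
  using positive_semidef_adjoint_mult[of P] by (simp add: orthogonal_projector_def hermitian_def)

lemma projector_unique:
  assumes P: "orthogonal_projector P" and Q: "orthogonal_projector Q"
    and ran: "range ((*v) P) = range ((*v) Q)"
  shows "P = Q"
proof -
  have absorb: "A ** B = B"
    if A: "orthogonal_projector A" and sub: "range ((*v) B) \<subseteq> range ((*v) A)"
    for A B :: "complex^'n^'n"
  proof -
    have "A *v (B *v x) = B *v x" for x
    proof -
      obtain y where "B *v x = A *v y"
        using sub by blast
      then show ?thesis
        using A by (simp add: orthogonal_projector_def matrix_vector_mul_assoc)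
    qed
    then show ?thesis
      by (simp add: matrix_eq matrix_vector_mul_assoc)
  qed
  \<comment> \<open>Each projector fixes the range of the other, so \<open>Q ** P = P\<close> and
    \<open>P ** Q = Q\<close>; taking the adjoint of the first product identifies the two.\<close>
  have "P = mat_adjoint (Q ** P)"
    using absorb[OF Q, of P] P ran by (simp add: orthogonal_projector_def hermitian_def)
  also have "\<dots> = P ** Q"
    using P Q by (simp add: orthogonal_projector_def hermitian_def mat_adjoint_mult)
  also have "\<dots> = Q"
    using absorb[OF P, of Q] ran by simp
  finally show ?thesis .
qed

text \<open>A complex scalar moves to the other argument as its conjugate, and \<open>E\<close> is
  closed under complex scaling. This makes the real orthogonal projection complex linear.\<close>

lemma orthogonal_vector_scalar_mult:
  fixes x y :: "complex^'n"
  assumes "\<And>w. w \<in> E \<Longrightarrow> orthogonal x w" and "vec.subspace E" and "w \<in> E"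
  shows "orthogonal (c *s x) w"
proof -
  have "(c *s x) \<bullet> w = x \<bullet> (cnj c *s w)"
    by (simp add: inner_vec_complex mult_ac)
  also have "\<dots> = 0"
    using assms by (simp add: orthogonal_def vec.subspace_scale)
  finally show ?thesis
    by (simp add: orthogonal_def)
qed

lemma projector_exists:
  fixes E :: "(complex^'n) set"
  assumes E: "vec.subspace E"
  obtains P where "orthogonal_projector P" "range ((*v) P) = E"
proof -
  have sub: "subspace E"
    using E by (auto simp: subspace_def vec.subspace_def simp flip: of_real_vector_scalar_mult)
  have "\<exists>y. y \<in> E \<and> (\<forall>w\<in>E. orthogonal (x - y) w)" for x
  proof -
    obtain y z where "y \<in> span E" "\<And>w. w \<in> span E \<Longrightarrow> orthogonal z w" "x = y + z"
      using orthogonal_subspace_decomp_exists by blast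
    moreover have "span E = E"
      using sub by simp
    ultimately show ?thesis by auto
  qed
  then obtain p where pE: "\<And>x. p x \<in> E" and pO: "\<And>x w. w \<in> E \<Longrightarrow> orthogonal (x - p x) w"
    by metis
  \<comment> \<open>Membership in \<open>E\<close> and orthogonality of the remainder determine
    \<open>p x\<close>: two candidates differ by a vector of \<open>E\<close> that is orthogonal to
    itself. Linearity of \<open>p\<close> and its identity on \<open>E\<close> both follow from
    this.\<close>
  have uniq: "p x = y" if y: "y \<in> E" and o: "\<And>w. w \<in> E \<Longrightarrow> orthogonal (x - y) w" for x y
  proof -
    have d: "p x - y \<in> E"
      using sub pE y by (simp add: subspace_diff)
    have "(p x - y) \<bullet> (p x - y) = (x - y) \<bullet> (p x - y) - (x - p x) \<bullet> (p x - y)"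
      by (simp add: inner_diff_left)
    also have "\<dots> = 0"
      using pO[OF d, of x] o[OF d] by (simp add: orthogonal_def)
    finally show ?thesis by simp
  qed
  have lin: "Vector_Spaces.linear (*s) (*s) p"
  proof (unfold_locales)
    fix x y
    show "p (x + y) = p x + p y"
    proof (rule uniq)
      show "p x + p y \<in> E" using sub pE by (simp add: subspace_add)
      fix w assume "w \<in> E"
      then show "orthogonal (x + y - (p x + p y)) w"
        using pO[of w x] pO[of w y] by (simp add: orthogonal_def algebra_simps)
    qed
  next
    fix c x
    show "p (c *s x) = c *s p x"
    proof (rule uniq)
      show "c *s p x \<in> E" using E pE by (simp add: vec.subspace_scale)
      fix w assume "w \<in> E"
      then have "orthogonal (c *s (x - p x)) w"
        using orthogonal_vector_scalar_mult[OF pO E] by blast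
      then show "orthogonal (c *s x - c *s p x) w"
        by (simp add: vec.scale_right_diff_distrib)
    qed
  qed
  define P where "P = matrix p"
  have P: "P *v x = p x" for x
    unfolding P_def by (rule matrix_works[OF lin])
  have pfix: "p y = y" if "y \<in> E" for y
    using uniq[OF that, of y] by (simp add: orthogonal_def)
  \<comment> \<open>The right-hand side is symmetric in \<open>x\<close> and \<open>y\<close>, which
    yields that \<open>P\<close> is Hermitian.\<close>
  have pin: "p x \<bullet> y = p x \<bullet> p y" for x y
    using pO[OF pE, of y x] by (simp add: orthogonal_def inner_diff_right inner_commute)
  show ?thesis
  proof
    show "range ((*v) P) = E"
    proof
      show "range ((*v) P) \<subseteq> E"
        using pE by (auto simp: P)
      show "E \<subseteq> range ((*v) P)"
        using pfix by (metis P rangeI subsetI)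
    qed
    have "hermitian P"
      unfolding hermitian_iff_inner P using pin by (metis inner_commute)
    moreover have "P ** P = P"
      by (simp add: matrix_eq P pfix pE flip: matrix_vector_mul_assoc)
    ultimately show "orthogonal_projector P"
      by (simp add: orthogonal_projector_def)
  qed
qed


section \<open>The spectral theorem\<close>

lemma eigenspace_subspace: "vec.subspace (eigenspace A l)"
  by (auto simp: vec.subspace_def eigenspace_def matrix_vector_right_distrib
      vec.scale_right_distrib vec.scale mult.commute)

text \<open>Existence and uniqueness of the projector onto a subspace give the definite description
  in \<open>eigenprojector\<close> its meaning.\<close>

lemma eigenprojector_props:
  shows orthogonal_projector_eigenprojector: "orthogonal_projector (eigenprojector A l)"
    and range_eigenprojector: "range ((*v) (eigenprojector A l)) = eigenspace A l"
proof -
  let ?Q = "\<lambda>P. orthogonal_projector P \<and> range ((*v) P) = eigenspace A l"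
  have "\<exists>!P. ?Q P"
    using projector_exists[OF eigenspace_subspace[of A l]] projector_unique by metis
  then have "?Q (eigenprojector A l)"
    unfolding eigenprojector_def by (rule theI')
  then show "orthogonal_projector (eigenprojector A l)"
    "range ((*v) (eigenprojector A l)) = eigenspace A l"
    by auto
qed

lemma mult_eigenprojector: "A ** eigenprojector A l = l *\<^sub>R eigenprojector A l"
proof -
  have "eigenprojector A l *v x \<in> eigenspace A l" for x
    using range_eigenprojector[of A l] by blast
  then show ?thesis
    by (simp add: matrix_eq eigenspace_def of_real_vector_scalar_mult scaleR_matrix_vector_mult
        flip: matrix_vector_mul_assoc)
qed

lemma eigenprojector_mult:
  assumes "hermitian A"
  shows "eigenprojector A l ** A = l *\<^sub>R eigenprojector A l"
proof -
  have "mat_adjoint (A ** eigenprojector A l) = mat_adjoint (l *\<^sub>R eigenprojector A l)"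
    by (simp add: mult_eigenprojector)
  then show ?thesis
    using assms orthogonal_projector_eigenprojector[of A l]
    by (simp add: mat_adjoint_mult mat_adjoint_scaleR hermitian_def orthogonal_projector_def)
qed

lemma eigenprojector_fixes:
  assumes "x \<in> eigenspace A l"
  shows "eigenprojector A l *v x = x"
proof -
  obtain y where "x = eigenprojector A l *v y"
    using assms range_eigenprojector[of A l] by blast
  then show ?thesis
    using orthogonal_projector_eigenprojector[of A l]
    by (simp add: orthogonal_projector_def matrix_vector_mul_assoc)
qed

text \<open>Evaluating the product with \<open>A\<close> in the middle from the left gives the
  factor \<open>l\<close>, from the right the factor \<open>m\<close>.\<close>

lemma eigenprojector_orthogonal:
  assumes "hermitian A" "l \<noteq> m"
  shows "eigenprojector A l ** eigenprojector A m = 0"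
proof -
  let ?P = "eigenprojector A"
  have "l *\<^sub>R (?P l ** ?P m) = ?P l ** A ** ?P m"
    by (simp add: eigenprojector_mult[OF assms(1)] scalar_matrix_assoc)
  also have "\<dots> = m *\<^sub>R (?P l ** ?P m)"
    by (simp add: mult_eigenprojector matrix_scalar_ac scalar_matrix_assoc flip: matrix_mul_assoc)
  finally show ?thesis
    using assms(2) by simp
qed

text \<open>Choosing one eigenvector per eigenvalue gives pairwise orthogonal nonzero vectors. They
  are distinct, and finite dimension leaves room for only finitely many.\<close>

lemma finite_real_eigenvalues:
  assumes "hermitian A"
  shows "finite (real_eigenvalues A)"
proof -
  have "\<forall>l\<in>real_eigenvalues A. \<exists>x. x \<noteq> 0 \<and> x \<in> eigenspace A l"
    by (simp add: real_eigenvalues_def)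
  then obtain v where v: "\<And>l. l \<in> real_eigenvalues A \<Longrightarrow> v l \<noteq> 0 \<and> v l \<in> eigenspace A l"
    by metis
  have orth: "v l \<bullet> v m = 0"
    if "l \<in> real_eigenvalues A" "m \<in> real_eigenvalues A" "l \<noteq> m" for l m
  proof -
    have "v l \<bullet> v m = (eigenprojector A l *v v l) \<bullet> (eigenprojector A m *v v m)"
      using that v eigenprojector_fixes by metis
    also have "\<dots> = v l \<bullet> ((eigenprojector A l ** eigenprojector A m) *v v m)"
      using orthogonal_projector_eigenprojector[of A l]
      by (simp add: orthogonal_projector_def hermitian_iff_inner matrix_vector_mul_assoc)
    also have "\<dots> = 0"
      by (simp add: eigenprojector_orthogonal[OF assms that(3)])
    finally show ?thesis .
  qed
  have "finite (v ` real_eigenvalues A)"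
  proof (rule pairwise_orthogonal_imp_finite)
    show "pairwise orthogonal (v ` real_eigenvalues A)"
      using orth by (auto simp: pairwise_def orthogonal_def)
  qed
  moreover have "inj_on v (real_eigenvalues A)"
    using orth v by (metis inj_onI inner_eq_zero_iff)
  ultimately show ?thesis
    by (simp add: finite_image_iff)
qed

text \<open>A maximiser of the quadratic form of \<open>A\<close> on the unit sphere of \<open>W\<close> is an eigenvector.\<close>

lemma hermitian_eigenvector_in_subspace:
  fixes A :: "complex^'n^'n"
  assumes A: "hermitian A" and W: "subspace W" and inv: "\<And>x. x \<in> W \<Longrightarrow> A *v x \<in> W"
    and w: "w \<in> W" "w \<noteq> 0"
  obtains l x where "x \<in> W" "x \<noteq> 0" "x \<in> eigenspace A l"
proof -
  have "compact (sphere 0 1 \<inter> W)"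
    using W by (simp add: closed_subspace compact_Int_closed)
  moreover have "w /\<^sub>R norm w \<in> sphere 0 1 \<inter> W"
    using W w by (simp add: subspace_scale)
  moreover have "continuous_on (sphere 0 1 \<inter> W) (\<lambda>x. x \<bullet> (A *v x))"
    by (intro continuous_on_inner continuous_on_id linear_continuous_on) simp
  ultimately obtain x where x: "x \<in> sphere 0 1 \<inter> W"
    and max: "\<And>y. y \<in> sphere 0 1 \<inter> W \<Longrightarrow> y \<bullet> (A *v y) \<le> x \<bullet> (A *v x)"
    using continuous_attains_sup[of "sphere 0 1 \<inter> W" "\<lambda>x. x \<bullet> (A *v x)"] by blast
  define M where "M = x \<bullet> (A *v x)"
  \<comment> \<open>The residual of the eigenvalue equation at the maximiser \<open>x\<close>; the
    goal is to show that it vanishes.\<close>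
  define y where "y = M *\<^sub>R x - A *v x"
  have nx: "x \<bullet> x = 1" "x \<in> W" "x \<noteq> 0"
    using x by (auto simp: norm_eq_1)
  have yW: "y \<in> W"
    unfolding y_def using W inv nx by (simp add: subspace_diff subspace_scale)
  have sym: "(A *v u) \<bullet> v = u \<bullet> (A *v v)" for u v
    using A by (simp add: hermitian_iff_inner)
  have form: "z \<bullet> (A *v z) \<le> M * (z \<bullet> z)" if "z \<in> W" for z
  proof (cases "z = 0")
    case False
    then have "z /\<^sub>R norm z \<in> sphere 0 1 \<inter> W"
      using W that by (simp add: subspace_scale)
    from max[OF this] have "(z \<bullet> (A *v z)) / (norm z)\<^sup>2 \<le> M"
      by (simp add: M_def matrix_vector_mult_scaleR_complex power2_eq_square field_simps)
    then show ?thesis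
      using False by (simp add: dot_square_norm field_simps)
  qed simp
  define f where "f = M * (y \<bullet> y) - y \<bullet> (A *v y)"
  \<comment> \<open>The form M |z|^2 - <z, A z> is nonnegative on \<open>W\<close> and zero at
    \<open>x\<close>. Moving from \<open>x\<close> along \<open>y\<close> has first-order
    coefficient 2 |y|^2, which must vanish at a minimum.\<close>
  have quad: "0 \<le> 2 * t * (y \<bullet> y) + t\<^sup>2 * f" for t
  proof -
    have "x + t *\<^sub>R y \<in> W"
      using W nx yW by (simp add: subspace_add subspace_scale)
    from form[OF this]
    have "0 \<le> M * ((x + t *\<^sub>R y) \<bullet> (x + t *\<^sub>R y)) - (x + t *\<^sub>R y) \<bullet> (A *v (x + t *\<^sub>R y))"
      by simp
    also have "\<dots> = 2 * t * (M * (x \<bullet> y) - (A *v x) \<bullet> y) + t\<^sup>2 * f"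
      using sym[of x y] nx
      by (simp add: f_def M_def inner_simps matrix_vector_right_distrib
          matrix_vector_mult_scaleR_complex inner_commute power2_eq_square)
        (simp add: algebra_simps inner_commute)
    also have "M * (x \<bullet> y) - (A *v x) \<bullet> y = y \<bullet> y"
      by (simp add: y_def inner_diff_left)
    finally show ?thesis .
  qed
  have "y \<bullet> y = 0"
  proof (rule ccontr)
    assume "y \<bullet> y \<noteq> 0"
    then have pos: "y \<bullet> y > 0" by simp
    \<comment> \<open>Negative, and so small that the quadratic term cancels at most half of the
      linear one; the \<open>+ 1\<close> avoids division by zero.\<close>
    define t where "t = - (y \<bullet> y) / (\<bar>f\<bar> + 1)"
    have "t < 0" using pos by (simp add: t_def divide_neg_pos)
    have "t\<^sup>2 * f \<le> t\<^sup>2 * (\<bar>f\<bar> + 1)"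
      by (intro mult_left_mono) auto
    also have "\<dots> = - t * (y \<bullet> y)"
      by (simp add: t_def power2_eq_square)
    finally have "2 * t * (y \<bullet> y) + t\<^sup>2 * f \<le> t * (y \<bullet> y)"
      by simp
    moreover have "t * (y \<bullet> y) < 0"
      using \<open>t < 0\<close> pos by (simp add: mult_neg_pos)
    ultimately show False
      using quad[of t] by linarith
  qed
  then have "x \<in> eigenspace A M"
    by (simp add: y_def eigenspace_def of_real_vector_scalar_mult)
  with nx show ?thesis
    using that by blast
qed

text \<open>The common kernel \<open>W\<close> of the eigenprojectors is invariant under
  \<open>A\<close>. Were it nonzero, it would contain an eigenvector, which its own eigenprojector
  both fixes and kills. So \<open>W\<close> is trivial, and it contains what the sum of the
  projectors misses of any vector.\<close>

lemma sum_eigenprojector: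
  fixes A :: "complex^'n^'n"
  assumes A: "hermitian A"
  shows "(\<Sum>l\<in>real_eigenvalues A. eigenprojector A l) = mat 1"
proof -
  let ?L = "real_eigenvalues A" and ?P = "eigenprojector A"
  define W where "W = {x. \<forall>l\<in>?L. ?P l *v x = 0}"
  have W: "subspace W"
    by (auto simp: W_def subspace_def matrix_vector_right_distrib matrix_vector_mult_scaleR_complex)
  have inv: "A *v x \<in> W" if "x \<in> W" for x
    using that
    by (simp add: W_def matrix_vector_mul_assoc eigenprojector_mult[OF A]
        scaleR_matrix_vector_mult)
  have trivial: "x = 0" if xW: "x \<in> W" for x
  proof (rule ccontr)
    assume "x \<noteq> 0"
    obtain l v where v: "v \<in> W" "v \<noteq> 0" "v \<in> eigenspace A l"
      using hermitian_eigenvector_in_subspace[OF A W inv xW \<open>x \<noteq> 0\<close>] by blast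
    then have "l \<in> ?L"
      by (auto simp: real_eigenvalues_def)
    with v show False
      using eigenprojector_fixes[of v A l] by (simp add: W_def)
  qed
  have "x - (\<Sum>l\<in>?L. ?P l) *v x \<in> W" for x
  proof -
    have "?P m *v ((\<Sum>l\<in>?L. ?P l) *v x) = ?P m *v x" if m: "m \<in> ?L" for m
    proof -
      have "?P m ** (\<Sum>l\<in>?L. ?P l) = (\<Sum>l\<in>?L. if l = m then ?P m else 0)"
        unfolding matrix_mult_sum_right
        using orthogonal_projector_eigenprojector[of A m] eigenprojector_orthogonal[OF A]
        by (intro sum.cong) (auto simp: orthogonal_projector_def)
      also have "\<dots> = ?P m"
        using m finite_real_eigenvalues[OF A] by simp
      finally show ?thesis
        by (simp add: matrix_vector_mul_assoc)
    qed
    then show ?thesis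
      by (simp add: W_def matrix_vector_mult_diff_distrib)
  qed
  then show ?thesis
    using trivial by (metis eq_iff_diff_eq_0 matrix_eq matrix_vector_mul_lid)
qed

lemma spectral_decomposition:
  assumes "hermitian A"
  shows "A = (\<Sum>l\<in>real_eigenvalues A. l *\<^sub>R eigenprojector A l)"
proof -
  have "A = A ** (\<Sum>l\<in>real_eigenvalues A. eigenprojector A l)"
    by (simp add: sum_eigenprojector[OF assms])
  then show ?thesis
    by (simp add: matrix_mult_sum_right mult_eigenprojector)
qed

text \<open>At \<open>l = 0\<close> the coefficient vanishes whatever \<open>f 0\<close> is; for the
  logarithm this is the convention 0 log 0 = 0.\<close>

lemma mult_hermitian_fun:
  "A ** hermitian_fun f A = (\<Sum>l\<in>real_eigenvalues A. (f l * l) *\<^sub>R eigenprojector A l)"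
  by (simp add: hermitian_fun_def matrix_mult_sum_right matrix_scalar_ac mult_eigenprojector
      scalar_matrix_assoc[symmetric])

lemma positive_semidef_eigenvalue_nonneg:
  assumes "positive_semidef A" "l \<in> real_eigenvalues A"
  shows "0 \<le> l"
proof -
  obtain x where "x \<noteq> 0" "A *v x = l *\<^sub>R x"
    using assms(2) by (auto simp: real_eigenvalues_def eigenspace_def of_real_vector_scalar_mult)
  moreover have "0 \<le> x \<bullet> (A *v x)"
    using assms(1) by (simp add: positive_semidef_iff_inner)
  moreover have "0 < x \<bullet> x"
    using \<open>x \<noteq> 0\<close> by simp
  ultimately show ?thesis
    by (simp add: zero_le_mult_iff del: inner_gt_zero_iff)
qed

lemma positive_semidef_square_root:
  fixes A :: "complex^'n^'n"
  assumes A: "positive_semidef A"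
  obtains C :: "complex^'n^'n" where "A = mat_adjoint C ** C"
proof
  let ?L = "real_eigenvalues A" and ?P = "eigenprojector A"
  let ?C = "hermitian_fun sqrt A"
  have h: "hermitian A"
    using A by (simp add: positive_semidef_def)
  have "?C ** ?C = (\<Sum>l\<in>?L. \<Sum>m\<in>?L. (sqrt l * sqrt m) *\<^sub>R (?P l ** ?P m))"
    unfolding hermitian_fun_def
    by (simp add: matrix_mult_sum_left matrix_mult_sum_right matrix_scalar_ac
        scalar_matrix_assoc[symmetric] scaleR_sum_right) (subst sum.swap, simp add: mult.commute)
  \<comment> \<open>Cross terms vanish by orthogonality; on the diagonal
    \<open>sqrt l * sqrt l = l\<close> because eigenvalues are nonnegative.\<close>
  also have "\<dots> = (\<Sum>l\<in>?L. \<Sum>m\<in>?L. if m = l then l *\<^sub>R ?P l else 0)"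
    using orthogonal_projector_eigenprojector[of A] eigenprojector_orthogonal[OF h]
      positive_semidef_eigenvalue_nonneg[OF A]
    by (intro sum.cong) (auto simp: orthogonal_projector_def)
  also have "\<dots> = A"
    using finite_real_eigenvalues[OF h] spectral_decomposition[OF h] by simp
  finally have "A = ?C ** ?C" ..
  moreover have "mat_adjoint ?C = ?C"
    using orthogonal_projector_eigenprojector[of A]
    by (simp add: hermitian_fun_def mat_adjoint_sum mat_adjoint_scaleR orthogonal_projector_def
        hermitian_def)
  ultimately show "A = mat_adjoint ?C ** ?C"
    by simp
qed


section \<open>Product states\<close>

lemma sum_UNIV_prod: "(\<Sum>p\<in>UNIV. f (fst p) * g (snd p)) = (\<Sum>a\<in>UNIV. f a) * (\<Sum>b\<in>UNIV. g b)"
  for f :: "'a::finite \<Rightarrow> 'c::comm_semiring_0" and g :: "'b::finite \<Rightarrow> 'c"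
  unfolding sum_product sum.cartesian_product UNIV_Times_UNIV by (simp add: case_prod_unfold)

lemma tensor_mat_mult: "tensor_mat A B ** tensor_mat C D = tensor_mat (A ** C) (B ** D)"
proof -
  have "(\<Sum>p\<in>UNIV. (A $ i $ fst p * C $ fst p $ j) * (B $ k $ snd p * D $ snd p $ l))
      = (A ** C) $ i $ j * (B ** D) $ k $ l" for i j k l
    using sum_UNIV_prod[of "\<lambda>a. A $ i $ a * C $ a $ j" "\<lambda>b. B $ k $ b * D $ b $ l"]
    by (simp add: matrix_matrix_mult_def)
  then show ?thesis
    by (simp add: tensor_mat_def vec_eq_iff matrix_matrix_mult_def mult_ac)
qed

lemma mat_adjoint_tensor_mat: "mat_adjoint (tensor_mat A B) = tensor_mat (mat_adjoint A) (mat_adjoint B)"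
  by (simp add: vec_eq_iff tensor_mat_def)

lemma trace_tensor_mat: "trace (tensor_mat A B) = trace A * trace B"
  using sum_UNIV_prod[of "\<lambda>a. A $ a $ a" "\<lambda>b. B $ b $ b"] by (simp add: trace_def tensor_mat_def)

text \<open>Square roots \<open>C\<close> and \<open>D\<close> of the factors make the tensor
  product equal to X* X with \<open>X = tensor_mat C D\<close>, so positivity is immediate.\<close>

lemma density_matrix_tensor_mat:
  fixes A :: "complex^'a^'a" and B :: "complex^'b^'b"
  assumes "density_matrix A" "density_matrix B"
  shows "density_matrix (tensor_mat A B)"
proof -
  obtain C :: "complex^'a^'a" and D :: "complex^'b^'b" where "A = mat_adjoint C ** C" "B = mat_adjoint D ** D"
    using assms positive_semidef_square_root unfolding density_matrix_def by metis
  then have "tensor_mat A B = mat_adjoint (tensor_mat C D) ** tensor_mat C D"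
    by (simp add: tensor_mat_mult mat_adjoint_tensor_mat)
  then have "positive_semidef (tensor_mat A B)"
    by (simp add: positive_semidef_adjoint_mult)
  then show ?thesis
    using assms by (simp add: density_matrix_def trace_tensor_mat)
qed


section \<open>Rank-one projectors and measurements\<close>

text \<open>Rank one means that the entries factor as \<open>c i * b $ j\<close>, so the square of
  \<open>P\<close> is \<open>P\<close> scaled by its trace. Comparing one nonzero entry gives trace
  1.\<close>

lemma trace_rank_one_projector:
  fixes P :: "complex^'n^'n"
  assumes P: "P ** P = P" and rk: "rank P = 1"
  shows "trace P = 1"
proof -
  obtain B where B: "B \<subseteq> rows P" "vec.independent B" "rows P \<subseteq> vec.span B"
    "card B = vec.dim (rows P)"
    using vec.basis_exists by blast
  then obtain b where b: "B = {b}"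
    using rk by (auto simp: row_rank_def_gen card_1_singleton_iff)
  have "\<exists>c. row i P = c *s b" for i
  proof -
    have "row i P \<in> vec.span {b}"
      using B(3) b by (auto simp: rows_def)
    then show ?thesis
      by (auto simp: vec.span_singleton)
  qed
  then obtain c where "\<And>i. row i P = c i *s b"
    by metis
  then have c: "P $ i $ j = c i * b $ j" for i j
    by (metis row_def vec_lambda_eta vector_smult_component)
  have "b \<noteq> 0"
    using B(2) b by auto
  then obtain j where j: "b $ j \<noteq> 0"
    by (auto simp: vec_eq_iff)
  \<comment> \<open>The basis vector is itself a row, so a nonzero coordinate of \<open>b\<close> is
    a nonzero entry of \<open>P\<close>.\<close>
  have "b \<in> rows P"
    using B b by auto
  then obtain i where i: "row i P = b"
    by (auto simp: rows_def)
  have nz: "P $ i $ j \<noteq> 0"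
    using i j by (auto simp: row_def)
  have "P $ i $ j = (P ** P) $ i $ j"
    by (simp add: P)
  also have "\<dots> = P $ i $ j * trace P"
    by (simp add: matrix_matrix_mult_def trace_def c sum_distrib_left mult_ac)
  finally show ?thesis
    using nz by simp
qed

text \<open>Projectors onto the standard basis vectors, the witnesses that product states and
  measurements exist.\<close>

definition unit_projector :: "'n::finite \<Rightarrow> complex^'n^'n" where
  "unit_projector k = (\<chi> i j. if i = k \<and> j = k then 1 else 0)"

lemma unit_projector_mult:
  "unit_projector k ** unit_projector l = (if k = l then unit_projector k else 0)"
proof -
  have "(\<Sum>m\<in>UNIV. (if i = k \<and> m = k then 1 else 0) * (if m = l \<and> j = l then 1 else (0::complex)))
     = (\<Sum>m\<in>UNIV. if m = k then (if i = k \<and> k = l \<and> j = l then 1 else 0) else 0)" for i j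
    by (rule sum.cong) auto
  then show ?thesis
    by (auto simp: unit_projector_def matrix_matrix_mult_def vec_eq_iff)
qed

lemma orthogonal_projector_unit_projector: "orthogonal_projector (unit_projector k)"
proof -
  have "hermitian (unit_projector k)"
    by (auto simp: hermitian_def vec_eq_iff unit_projector_def)
  then show ?thesis
    by (simp add: orthogonal_projector_def unit_projector_mult)
qed

lemma rank_unit_projector: "rank (unit_projector k) = 1"
proof -
  have k: "row k (unit_projector k) = axis k 1"
    by (auto simp: row_def unit_projector_def axis_def vec_eq_iff)
  moreover have "row i (unit_projector k) = 0" if "i \<noteq> k" for i
    using that by (auto simp: row_def unit_projector_def vec_eq_iff)
  ultimately have "rows (unit_projector k) \<subseteq> insert 0 {axis k 1}"
    by (fastforce simp: rows_def)
  moreover have "axis k 1 \<in> rows (unit_projector k)"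
    unfolding rows_def using k by (metis (mono_tags, lifting) UNIV_I mem_Collect_eq)
  \<comment> \<open>Discarding the zero row keeps the span and also covers dimension one, where no
    such row occurs.\<close>
  ultimately have "rows (unit_projector k) - {0} = {axis k (1::complex)}"
    by auto
  then have "vec.span (rows (unit_projector k)) = vec.span {axis k 1}"
    by (metis vec.span_delete_0)
  then show ?thesis
    unfolding row_rank_def_gen by (metis axis_eq_0_iff vec.dim_singleton vec.dim_span zero_neq_one)
qed

lemma density_matrix_unit_projector: "density_matrix (unit_projector k)"
  using orthogonal_projector_unit_projector[of k] rank_unit_projector[of k]
  by (simp add: density_matrix_def projector_positive_semidef trace_rank_one_projector
      orthogonal_projector_def)

lemma product_states_nonempty: "product_states \<noteq> {}"
  unfolding product_states_def using density_matrix_unit_projector by blast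

lemma von_neumann_measurement_exists: "\<exists>\<P>. von_neumann_measurement (\<P> :: (complex^'n^'n) set)"
proof -
  \<comment> \<open>Measurements are sets, so injectivity is needed to turn the sum over projectors
    into a sum over basis indices.\<close>
  have "inj (unit_projector :: 'n \<Rightarrow> _)"
    by (rule injI) (auto simp: unit_projector_def vec_eq_iff split: if_splits)
  then have "(\<Sum>P\<in>range unit_projector. P) = (\<Sum>k\<in>UNIV. unit_projector (k::'n))"
    by (simp add: sum.reindex)
  also have "\<dots> = mat 1"
    by (auto simp: vec_eq_iff unit_projector_def mat_def intro!: sum.neutral)
  finally have "von_neumann_measurement (range (unit_projector :: 'n \<Rightarrow> _))"
    using orthogonal_projector_unit_projector rank_unit_projector unit_projector_mult
    unfolding von_neumann_measurement_def by (smt (verit) finite_imageI finite_class.finite_UNIV imageE)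
  then show ?thesis ..
qed

text \<open>Take the trace of the completeness relation: each rank-one projector contributes 1, the
  identity contributes the dimension.\<close>

lemma card_von_neumann_measurement:
  fixes \<P> :: "(complex^'n^'n) set"
  assumes "von_neumann_measurement \<P>"
  shows "card \<P> = CARD('n)"
proof -
  have "of_nat (card \<P>) = (\<Sum>P\<in>\<P>. trace P)"
    using assms by (simp add: von_neumann_measurement_def orthogonal_projector_def
        trace_rank_one_projector)
  also have "\<dots> = trace (\<Sum>P\<in>\<P>. P)"
    by (simp add: trace_sum)
  also have "\<dots> = (of_nat CARD('n) :: complex)"
    using assms by (simp add: von_neumann_measurement_def trace_I)
  finally show ?thesis
    using of_nat_eq_iff by blast
qed


section \<open>Entropy inequalities\<close>

text \<open>The left side is the tangent line to the convex function x ln x at \<open>y\<close>; the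
  bound is ln t \<le> t - 1 at t = y / x.\<close>

lemma klein_inequality:
  fixes x y :: real
  assumes "0 \<le> x" "0 < y"
  shows "x * ln y + (x - y) \<le> x * ln x"
proof (cases "x = 0")
  case False
  with assms have "ln (y / x) \<le> y / x - 1"
    by (intro ln_le_minus_one) simp
  then have "x * (ln y - ln x) \<le> x * (y / x - 1)"
    using assms False by (intro mult_left_mono) (simp_all add: ln_div)
  also have "\<dots> = y - x"
    using False by (simp add: field_simps)
  finally show ?thesis
    by (simp add: algebra_simps)
qed (use assms in simp)

text \<open>Average the tangent-line bounds at the mean \<open>q\<close>; the corrections
  \<open>l i - q\<close> cancel since the weights sum to 1. For \<open>q = 0\<close>, where no
  tangent exists, every product \<open>w i * l i\<close> is zero.\<close>

lemma jensen_x_log_x: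
  fixes w l :: "'a \<Rightarrow> real"
  assumes fin: "finite L" and w: "\<And>i. i \<in> L \<Longrightarrow> 0 \<le> w i" and sw: "sum w L = 1"
    and l: "\<And>i. i \<in> L \<Longrightarrow> 0 \<le> l i" and q: "q = (\<Sum>i\<in>L. w i * l i)"
  shows "q * log 2 q \<le> (\<Sum>i\<in>L. w i * (l i * log 2 (l i)))"
proof (cases "q = 0")
  case True
  then have "w i * l i = 0" if "i \<in> L" for i
    using q w l fin that sum_nonneg_eq_0_iff[of L "\<lambda>i. w i * l i"] by simp
  then show ?thesis
    using True by (simp add: sum.neutral flip: mult.assoc)
next
  case False
  moreover have "0 \<le> q"
    unfolding q using w l by (simp add: sum_nonneg)
  ultimately have q0: "0 < q" by simp
  have "(\<Sum>i\<in>L. w i * (l i * ln q + (l i - q))) = (\<Sum>i\<in>L. w i * l i * ln q + w i * l i - w i * q)"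
    by (simp add: algebra_simps)
  also have "\<dots> = q * ln q + q - sum w L * q"
    by (simp add: sum.distrib sum_subtractf q flip: sum_distrib_right)
  finally have "q * ln q = (\<Sum>i\<in>L. w i * (l i * ln q + (l i - q)))"
    by (simp add: sw)
  also have "\<dots> \<le> (\<Sum>i\<in>L. w i * (l i * ln (l i)))"
    using w l q0 by (intro sum_mono mult_left_mono klein_inequality) auto
  finally have "q * ln q / ln 2 \<le> (\<Sum>i\<in>L. w i * (l i * ln (l i))) / ln 2"
    by (simp add: divide_right_mono)
  then show ?thesis
    by (simp add: log_def sum_divide_distrib)
qed

text \<open>Tangent lines at the uniform probability 1/N are summed; the corrections cancel because
  both distributions have total mass 1.\<close>

lemma entropy_le_log_card:
  fixes p :: "'a \<Rightarrow> real"
  assumes fin: "finite I" and p: "\<And>i. i \<in> I \<Longrightarrow> 0 \<le> p i" and sp: "sum p I = 1"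
  shows "- (\<Sum>i\<in>I. p i * log 2 (p i)) \<le> log 2 (card I)"
proof -
  define N where "N = real (card I)"
  have N: "0 < N"
    using sp fin by (auto simp: N_def card_gt_0_iff)
  have "- ln N = (\<Sum>i\<in>I. p i * ln (1 / N) + (p i - 1 / N))"
    using N by (simp add: sum.distrib sum_subtractf sp N_def[symmetric] ln_div flip: sum_distrib_right)
  also have "\<dots> \<le> (\<Sum>i\<in>I. p i * ln (p i))"
    using p N by (intro sum_mono klein_inequality) auto
  finally have "- (\<Sum>i\<in>I. p i * ln (p i)) / ln 2 \<le> ln N / ln 2"
    by (intro divide_right_mono) auto
  then show ?thesis
    by (simp add: log_def sum_divide_distrib N_def)
qed

section \<open>Outcome distributions and their entropies\<close>

lemma outcome_prob_spectral:
  assumes "hermitian \<rho>"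
  shows "outcome_prob \<rho> P = (\<Sum>l\<in>real_eigenvalues \<rho>. Re (trace (eigenprojector \<rho> l ** P)) * l)"
proof -
  have "\<rho> ** P = (\<Sum>l\<in>real_eigenvalues \<rho>. l *\<^sub>R (eigenprojector \<rho> l ** P))"
    using arg_cong[OF spectral_decomposition[OF assms], of "\<lambda>A. A ** P"]
    by (simp only: matrix_mult_sum_left scalar_matrix_assoc)
  then show ?thesis
    by (simp add: outcome_prob_def trace_sum trace_scaleR mult.commute)
qed

lemma outcome_prob_nonneg:
  assumes "positive_semidef \<rho>" "orthogonal_projector P"
  shows "0 \<le> outcome_prob \<rho> P"
proof -
  have "hermitian \<rho>"
    using assms by (simp add: positive_semidef_def)
  then show ?thesis
    using assms
    by (auto simp: outcome_prob_spectral intro!: sum_nonneg mult_nonneg_nonneg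
        trace_projector_mult_nonneg orthogonal_projector_eigenprojector
        intro: positive_semidef_eigenvalue_nonneg)
qed

lemma sum_outcome_prob:
  assumes "density_matrix \<rho>" "von_neumann_measurement \<P>"
  shows "(\<Sum>P\<in>\<P>. outcome_prob \<rho> P) = 1"
proof -
  have "(\<Sum>P\<in>\<P>. outcome_prob \<rho> P) = Re (trace (\<rho> ** (\<Sum>P\<in>\<P>. P)))"
    by (simp add: outcome_prob_def matrix_mult_sum_right trace_sum)
  then show ?thesis
    using assms by (simp add: von_neumann_measurement_def density_matrix_def)
qed

lemma klein_entropy_le:
  fixes \<rho> :: "complex^'n^'n"
  assumes "density_matrix \<rho>" "von_neumann_measurement \<P>"
  shows "klein_entropy \<rho> \<P> \<le> log 2 (real CARD('n))"
  using entropy_le_log_card[of \<P> "outcome_prob \<rho>"] assms sum_outcome_prob[OF assms]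
    card_von_neumann_measurement[OF assms(2)] outcome_prob_nonneg[of \<rho>]
  by (simp add: klein_entropy_def von_neumann_measurement_def density_matrix_def)

text \<open>Each probability is at most 1, so its logarithm is nonpositive. This supplies the lower
  bound that the infimum over product states requires.\<close>

lemma klein_entropy_nonneg:
  assumes "density_matrix \<rho>" "von_neumann_measurement \<P>"
  shows "0 \<le> klein_entropy \<rho> \<P>"
proof -
  have nonneg: "0 \<le> outcome_prob \<rho> P" if "P \<in> \<P>" for P
    using assms that outcome_prob_nonneg[of \<rho>]
    by (simp add: von_neumann_measurement_def density_matrix_def)
  have "outcome_prob \<rho> P \<le> 1" if "P \<in> \<P>" for P
    using member_le_sum[of P \<P> "outcome_prob \<rho>"] that nonneg sum_outcome_prob[OF assms] assms(2)
    by (auto simp: von_neumann_measurement_def)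
  then have "outcome_prob \<rho> P * log 2 (outcome_prob \<rho> P) \<le> 0" if "P \<in> \<P>" for P
    using nonneg that by (cases "outcome_prob \<rho> P = 0") (force simp: mult_le_0_iff)+
  then show ?thesis
    by (simp add: klein_entropy_def sum_nonpos)
qed

lemma von_neumann_entropy_spectral:
  "von_neumann_entropy \<rho> =
    - (\<Sum>l\<in>real_eigenvalues \<rho>. l * log 2 l * Re (trace (eigenprojector \<rho> l)))"
  by (simp add: von_neumann_entropy_def mult_hermitian_fun trace_sum trace_scaleR mult.commute)

text \<open>
  The outcome distribution of a measurement is the image of the spectrum of \<open>\<rho>\<close> under the
  matrix with entries \<open>Re (trace (E\<^sub>l ** P))\<close>, whose sum over the spectral projectors \<open>E\<^sub>l\<close>
  is \<open>trace P = 1\<close> and whose sum over the outcomes \<open>P\<close> is the multiplicity of \<open>l\<close>.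
\<close>

lemma von_neumann_entropy_le_klein_entropy:
  assumes \<rho>: "density_matrix \<rho>" and \<P>: "von_neumann_measurement \<P>"
  shows "von_neumann_entropy \<rho> \<le> klein_entropy \<rho> \<P>"
proof -
  let ?L = "real_eigenvalues \<rho>" and ?w = "\<lambda>l P. Re (trace (eigenprojector \<rho> l ** P))"
  have psd: "positive_semidef \<rho>" and h: "hermitian \<rho>"
    using \<rho> by (simp_all add: density_matrix_def positive_semidef_def)
  have proj: "orthogonal_projector P" "rank P = 1" if "P \<in> \<P>" for P
    using \<P> that by (simp_all add: von_neumann_measurement_def)
  have "(\<Sum>P\<in>\<P>. outcome_prob \<rho> P * log 2 (outcome_prob \<rho> P))
      \<le> (\<Sum>P\<in>\<P>. \<Sum>l\<in>?L. ?w l P * (l * log 2 l))"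
  proof (intro sum_mono jensen_x_log_x)
    fix P assume P: "P \<in> \<P>"
    have "(\<Sum>l\<in>?L. ?w l P) = Re (trace ((\<Sum>l\<in>?L. eigenprojector \<rho> l) ** P))"
      by (simp add: matrix_mult_sum_left trace_sum)
    also have "\<dots> = 1"
      using proj[OF P]
      by (simp add: sum_eigenprojector[OF h] trace_rank_one_projector orthogonal_projector_def)
    finally show "(\<Sum>l\<in>?L. ?w l P) = 1" .
    show "outcome_prob \<rho> P = (\<Sum>l\<in>?L. ?w l P * l)"
      by (rule outcome_prob_spectral[OF h])
  qed (use proj psd h in \<open>auto intro: trace_projector_mult_nonneg finite_real_eigenvalues
        orthogonal_projector_eigenprojector positive_semidef_eigenvalue_nonneg\<close>)
  also have "\<dots> = (\<Sum>l\<in>?L. \<Sum>P\<in>\<P>. ?w l P * (l * log 2 l))"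
    by (rule sum.swap)
  \<comment> \<open>For fixed \<open>l\<close> the weights add up over the outcomes to a single
    trace, in which completeness then replaces the sum of projectors by the identity.\<close>
  also have "\<dots> = (\<Sum>l\<in>?L. l * log 2 l * Re (trace (eigenprojector \<rho> l ** (\<Sum>P\<in>\<P>. P))))"
    by (simp add: matrix_mult_sum_right trace_sum sum_distrib_left mult.commute)
  also have "\<dots> = - von_neumann_entropy \<rho>"
    using \<P> by (simp add: von_neumann_entropy_spectral von_neumann_measurement_def)
  finally show ?thesis
    by (simp add: klein_entropy_def)
qed

theorem proposition3:
  fixes \<rho> :: "complex^('d::finite \<times> 'd)^('d \<times> 'd)"
  assumes "density_matrix \<rho>"
  shows "entropic_entanglement \<rho> \<le> information_content \<rho>"
  unfolding entropic_entanglement_def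
proof (rule cSUP_least)
  show "{\<P> :: (complex^('d \<times> 'd)^('d \<times> 'd)) set. von_neumann_measurement \<P>} \<noteq> {}"
    using von_neumann_measurement_exists by blast
  fix \<P> :: "(complex^('d \<times> 'd)^('d \<times> 'd)) set"
  assume "\<P> \<in> {\<P>. von_neumann_measurement \<P>}"
  then have \<P>: "von_neumann_measurement \<P>" by simp
  have dens: "density_matrix \<delta>" if "\<delta> \<in> product_states" for \<delta> :: "complex^('d \<times> 'd)^('d \<times> 'd)"
    using that density_matrix_tensor_mat by (auto simp: product_states_def)
  \<comment> \<open>Any single product state suffices: the infimum lies below its Klein entropy,
    which the dimension already bounds.\<close>
  obtain \<delta> :: "complex^('d \<times> 'd)^('d \<times> 'd)" where \<delta>: "\<delta> \<in> product_states"
    using product_states_nonempty by blast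
  have "(INF \<delta>\<in>product_states. klein_entropy \<delta> \<P>) \<le> klein_entropy \<delta> \<P>"
    using \<delta> dens klein_entropy_nonneg[OF _ \<P>] by (intro cINF_lower bdd_belowI2[of _ 0]) auto
  also have "\<dots> \<le> log 2 (real CARD('d \<times> 'd))"
    by (rule klein_entropy_le[OF dens[OF \<delta>] \<P>])
  also have "\<dots> = 2 * log 2 (real CARD('d))"
    by (simp add: log_mult)
  finally show "(INF \<delta>\<in>product_states. klein_entropy \<delta> \<P>) - klein_entropy \<rho> \<P>
      \<le> information_content \<rho>"
    using von_neumann_entropy_le_klein_entropy[OF assms \<P>] by (simp add: information_content_def)
qed

end
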